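(* Let $v = p_1^{e_1}\cdots p_t^{e_t} \ge 3$ be an integer in prime factorization ($p_1,\dots,p_t$ distinct primes, $e_i\ge 1$), and let $k$ be a prime factor of $\gcd(p_1^{e_1}-1,\dots,p_t^{e_t}-1)$. Then there exists a $(v,k,1)$-RPMD that admits a Frobenius group $K\rtimes H$ with $|K|=v$ and $|H|=k$ as a group of automorphisms.
   Context: All sets and groups are finite. Mendelsohn designs. For integers $v\ge k\ge 2$, a $(v,k,1)$-Mendelsohn design, or $(v,k,1)$-MD, is a set $X$ of $v$ points together with a collection $\mathcal{B}$ of cyclically ordered $k$-subsets of $X$ (blocks) such that every ordered pair of distinct points is consecutive in exactly one block. In a block $(a_1,\dots,a_k)$ (cyclic order $a_1<a_2<\dots<a_k<a_1$), the ordered pair $(a_i,a_{i+t})$ is $t$-apart (subscripts modulo $k$); consecutive means $1$-apart. The design is perfect if for each $t=1,\dots,k-1$ every ordered pair of distinct points is $t$-apart in exactly one block. It is resolvable if either $v\equiv 0 \pmod k$ and the blocks can be partitioned into $v-1$ parts each consisting of $v/k$ pairwise disjoint blocks, or $v\equiv 1\pmod k$ and the blocks can be partitioned into $v$ parts each consisting of $(v-1)/k$ pairwise disjoint blocks. A $(v,k,1)$-RPMD is a resolvable perfect $(v,k,1)$-MD. An MD $(X,\mathcal{B})$ admits a group $G$ as a group of automorphisms if $G$ acts (not necessarily faithfully) on $X$ and preserves the set $\mathcal{B}$ of cyclically ordered blocks. Frobenius groups. $K\rtimes H$ is a Frobenius group if $H$ and $K$ are nontrivial, $H$ acts on $K$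 by group automorphisms, $K \rtimes H$ is the corresponding semidirect product, and $H$ is semiregular on $K\setminus\{1\}$, i.e. $h(x)=x$ with $h\in H$, $x\in K\setminus\{1\}$ implies $h=1_H$. *)

theory Defs
  imports "HOL-Algebra.Group_Action" "HOL-Library.Disjoint_Sets"
    "HOL-Computational_Algebra.Primes"
begin

(* A cyclically ordered set is the class of a duplicate-free list up to rotation. *)

definition cyc :: "'a list \<Rightarrow> 'a list set" where
  "cyc xs = {rotate n xs | n. True}"

definition cyclic_k_subsets :: "nat \<Rightarrow> 'a set \<Rightarrow> 'a list set set" where
  "cyclic_k_subsets k X = {cyc xs | xs. distinct xs \<and> length xs = k \<and> set xs \<subseteq> X}"

definition points :: "'a list set \<Rightarrow> 'a set" where
  "points B = (\<Union>xs\<in>B. set xs)"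

definition apart :: "nat \<Rightarrow> 'a list set \<Rightarrow> 'a \<Rightarrow> 'a \<Rightarrow> bool" where
  "apart t B x y \<longleftrightarrow>
     (\<exists>xs\<in>B. \<exists>i<length xs. x = xs ! i \<and> y = xs ! ((i + t) mod length xs))"

definition mendelsohn_design :: "nat \<Rightarrow> nat \<Rightarrow> 'a set \<Rightarrow> 'a list set set \<Rightarrow> bool" where
  "mendelsohn_design v k X \<B> \<longleftrightarrow>
     2 \<le> k \<and> k \<le> v \<and> finite X \<and> card X = v \<and> \<B> \<subseteq> cyclic_k_subsets k X \<and>
     (\<forall>x\<in>X. \<forall>y\<in>X. x \<noteq> y \<longrightarrow> (\<exists>!B. B \<in> \<B> \<and> apart 1 B x y))"

definition perfect_md :: "nat \<Rightarrow> nat \<Rightarrow> 'a set \<Rightarrow> 'a list set set \<Rightarrow> bool" where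
  "perfect_md v k X \<B> \<longleftrightarrow>
     mendelsohn_design v k X \<B> \<and>
     (\<forall>t\<in>{1..k - 1}. \<forall>x\<in>X. \<forall>y\<in>X. x \<noteq> y \<longrightarrow> (\<exists>!B. B \<in> \<B> \<and> apart t B x y))"

(* The blocks can be partitioned into r parts, each consisting of m pairwise disjoint blocks. *)
definition block_partition :: "nat \<Rightarrow> nat \<Rightarrow> 'a list set set \<Rightarrow> bool" where
  "block_partition r m \<B> \<longleftrightarrow>
     (\<exists>P. partition_on \<B> P \<and> finite P \<and> card P = r \<and>
       (\<forall>Q\<in>P. finite Q \<and> card Q = m \<and> disjoint_family_on points Q))"

definition resolvable_md :: "nat \<Rightarrow> nat \<Rightarrow> 'a set \<Rightarrow> 'a list set set \<Rightarrow> bool" where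
  "resolvable_md v k X \<B> \<longleftrightarrow>
     mendelsohn_design v k X \<B> \<and>
     (v mod k = 0 \<and> block_partition (v - 1) (v div k) \<B> \<or>
      v mod k = 1 \<and> block_partition v ((v - 1) div k) \<B>)"

definition rpmd :: "nat \<Rightarrow> nat \<Rightarrow> 'a set \<Rightarrow> 'a list set set \<Rightarrow> bool" where
  "rpmd v k X \<B> \<longleftrightarrow> perfect_md v k X \<B> \<and> resolvable_md v k X \<B>"

definition admits ::
  "'a set \<Rightarrow> 'a list set set \<Rightarrow> ('g, 'm) monoid_scheme \<Rightarrow> ('g \<Rightarrow> 'a \<Rightarrow> 'a) \<Rightarrow> bool" where
  "admits X \<B> G \<phi> \<longleftrightarrow>
     group_action G X \<phi> \<and>
     (\<forall>g\<in>carrier G. (\<lambda>B. map (\<phi> g) ` B) ` \<B> = \<B>)"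

definition semidirect ::
  "('a, 'm) monoid_scheme \<Rightarrow> ('b, 'n) monoid_scheme \<Rightarrow> ('b \<Rightarrow> 'a \<Rightarrow> 'a) \<Rightarrow> ('a \<times> 'b) monoid" where
  "semidirect K H \<theta> =
     \<lparr>carrier = carrier K \<times> carrier H,
      monoid.mult = (\<lambda>(x, g) (y, h). (x \<otimes>\<^bsub>K\<^esub> \<theta> g y, g \<otimes>\<^bsub>H\<^esub> h)),
      one = (\<one>\<^bsub>K\<^esub>, \<one>\<^bsub>H\<^esub>)\<rparr>"

(* The triple (K, H, \<theta>) gives rise to a Frobenius group semidirect K H \<theta>. *)
definition frobenius ::
  "('a, 'm) monoid_scheme \<Rightarrow> ('b, 'n) monoid_scheme \<Rightarrow> ('b \<Rightarrow> 'a \<Rightarrow> 'a) \<Rightarrow> bool" where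
  "frobenius K H \<theta> \<longleftrightarrow>
     group K \<and> group H \<and> finite (carrier K) \<and> finite (carrier H) \<and>
     carrier K \<noteq> {\<one>\<^bsub>K\<^esub>} \<and> carrier H \<noteq> {\<one>\<^bsub>H\<^esub>} \<and>
     group_hom H (AutoGroup K) \<theta> \<and>
     (\<forall>h\<in>carrier H. \<forall>x\<in>carrier K - {\<one>\<^bsub>K\<^esub>}. \<theta> h x = x \<longrightarrow> h = \<one>\<^bsub>H\<^esub>)"

lemma group_semidirect:
  assumes "group K" "group_hom H (AutoGroup K) \<theta>"
  shows "group (semidirect K H \<theta>)"
proof -
  interpret K: group K by fact
  interpret \<theta>: group_hom H "AutoGroup K" \<theta> by fact
  have aut: "\<theta> h \<in> auto K" if "h \<in> carrier H" for h
    using \<theta>.hom_closed[OF that] by (simp add: AutoGroup_def)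
  have cl [simp]: "\<theta> h x \<in> carrier K" if "h \<in> carrier H" "x \<in> carrier K" for h x
    using aut[OF that(1)] that(2) by (auto simp: auto_def hom_def)
  have hm: "\<theta> h (x \<otimes>\<^bsub>K\<^esub> y) = \<theta> h x \<otimes>\<^bsub>K\<^esub> \<theta> h y"
    if "h \<in> carrier H" "x \<in> carrier K" "y \<in> carrier K" for h x y
    using aut[OF that(1)] that by (auto simp: auto_def hom_def)
  have mt: "\<theta> (g \<otimes>\<^bsub>H\<^esub> h) x = \<theta> g (\<theta> h x)"
    if "g \<in> carrier H" "h \<in> carrier H" "x \<in> carrier K" for g h x
    using \<theta>.hom_mult[OF that(1,2)] aut[OF that(1)] aut[OF that(2)] that(3)
    by (simp add: AutoGroup_def BijGroup_def auto_def compose_def)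
  have id: "\<theta> \<one>\<^bsub>H\<^esub> x = x" if "x \<in> carrier K" for x
    using \<theta>.hom_one that by (simp add: AutoGroup_def BijGroup_def)
  show ?thesis
  proof (rule groupI)
    fix a assume a: "a \<in> carrier (semidirect K H \<theta>)"
    then obtain x h where xh: "a = (x, h)" "x \<in> carrier K" "h \<in> carrier H"
      by (auto simp: semidirect_def)
    show "\<exists>b\<in>carrier (semidirect K H \<theta>).
        b \<otimes>\<^bsub>semidirect K H \<theta>\<^esub> a = \<one>\<^bsub>semidirect K H \<theta>\<^esub>"
      by (rule bexI[of _ "(inv\<^bsub>K\<^esub> (\<theta> (inv\<^bsub>H\<^esub> h) x), inv\<^bsub>H\<^esub> h)"])
        (use xh in \<open>auto simp: semidirect_def simp del: \<theta>.hom_inv\<close>)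
  qed (auto simp: semidirect_def hm mt id K.m_assoc \<theta>.G.m_assoc
        simp del: \<theta>.hom_mult \<theta>.hom_one)
qed

end

theory Submission
  imports Defs "HOL-Algebra.Sylow" "HOL-Algebra.Multiplicative_Group" "HOL-Algebra.Product_Groups"
begin

text \<open>
  Everything follows from one object: a group \<open>K\<close> of order \<open>v\<close> with an automorphism \<open>\<omega>\<close>
  such that \<open>\<omega>\<^sup>k = id\<close> and \<open>\<omega>\<close> fixes only the identity.  Since \<open>k\<close> is prime, the powers
  \<open>\<omega>\<^sup>t\<close> with \<open>0 < t < k\<close> fix only the identity as well, so the powers of \<open>\<omega>\<close> form a Frobenius
  complement of order \<open>k\<close>.

  The blocks of the design are the cycles \<open>(x y, x \<omega>(y), \<dots>, x \<omega>\<^sup>k\<^sup>-\<^sup>1(y))\<close> for \<open>x\<close> in \<open>K\<close> and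
  \<open>y \<noteq> 1\<close>.  The decisive fact is that the displacement \<open>z \<mapsto> z\<^sup>-\<^sup>1 \<omega>\<^sup>t(z)\<close> is a permutation of
  \<open>K\<close> (\<open>displacement_bij\<close>): two points \<open>a\<close>, \<open>b\<close> are \<open>t\<close>-apart in a block \<open>(x, y)\<close> exactly when
  some \<open>z\<close> in the \<open>\<omega>\<close>-orbit of \<open>y\<close> satisfies \<open>a = x z\<close> and \<open>a\<^sup>-\<^sup>1 b = z\<^sup>-\<^sup>1 \<omega>\<^sup>t(z)\<close>.  The second
  equation determines \<open>z\<close>, the first then determines \<open>x\<close>, and the block depends on \<open>y\<close> only
  through its orbit (\<open>ex1_block_apart\<close>).  For fixed \<open>x\<close> the blocks are the translates by \<open>x\<close> of the \<open>\<omega>\<close>-orbits on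
  \<open>K - {1}\<close>, hence they partition \<open>K - {x}\<close>; these are the \<open>v\<close> parts of a resolution, and in
  particular \<open>v \<equiv> 1\<close> modulo \<open>k\<close>.  The maps \<open>z \<mapsto> x \<omega>\<^sup>i(z)\<close> permute the blocks.

  The existence of \<open>(K, \<omega>)\<close> passes to direct products, so prime powers \<open>p\<^sup>e\<close> with
  \<open>k dvd p\<^sup>e - 1\<close> suffice (\<open>fpf_order_prime_power\<close>).  There multiplication by a \<open>k\<close>-th root of unity in the field with
  \<open>p\<^sup>e\<close> elements would do, but no finite field is constructed here.  Instead, the
  automorphism group of the elementary abelian group of order \<open>p\<^sup>e\<close> is transitive on the
  \<open>p\<^sup>e - 1\<close> nonidentity elements (\<open>elementary_abelian_automorphism_to\<close>), so \<open>k\<close> divides its order and Sylow's theorem yields an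
  automorphism \<open>\<alpha>\<close> of order \<open>k\<close>.  Its fixed points form a subgroup of order \<open>p\<^sup>f\<close> with
  \<open>f < e\<close>.  If \<open>f = 0\<close> then \<open>\<alpha>\<close> is as wanted.  Otherwise the remaining \<open>p\<^sup>e - p\<^sup>f\<close> elements lie
  in orbits of length \<open>k\<close>, so \<open>k\<close> divides both \<open>p\<^sup>f - 1\<close> and \<open>p\<^sup>e\<^sup>-\<^sup>f - 1\<close>, and the direct
  product of smaller examples has order \<open>p\<^sup>e\<close>.
\<close>

section \<open>Maps of prime period\<close>

lemma funpow_in:
  assumes "f \<in> S \<rightarrow> S" "x \<in> S"
  shows "(f ^^ n) x \<in> S"
  using assms by (induction n) auto

text \<open>The exponents that fix \<open>x\<close> are closed under taking greatest common divisors, and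
  \<open>t\<close> is coprime to \<open>k\<close>.\<close>

lemma fixed_if_power_fixed:
  assumes "prime (k::nat)" "(f ^^ k) x = x" "(f ^^ t) x = x" "0 < t" "t < k"
  shows "f x = x"
proof -
  have "coprime t k"
    using assms by (metis coprime_commute nat_dvd_not_less prime_imp_coprime)
  then obtain a b where ab: "t * a = k * b + 1"
    using coprime_bezout_strong[of t k] assms(1) by (auto simp: prime_nat_iff)
  have "(f ^^ (t * a mod t)) x = (f ^^ (t * a)) x" "(f ^^ (k * b mod k)) x = (f ^^ (k * b)) x"
    by (rule funpow_mod_eq, fact)+
  then have "(f ^^ (t * a)) x = x" "(f ^^ (k * b)) x = x"
    by simp_all
  then show ?thesis
    using ab by simp
qed

text \<open>Every orbit has length exactly \<open>k\<close>, since a shorter one would contain a fixed point.\<close>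

lemma prime_period_dvd_card:
  assumes "finite S" "prime (k::nat)" and f: "f \<in> S \<rightarrow> S"
    and per: "\<And>x. x \<in> S \<Longrightarrow> (f ^^ k) x = x"
    and free: "\<And>x. x \<in> S \<Longrightarrow> f x \<noteq> x"
  shows "k dvd card S"
proof -
  define orb where "orb x = range (\<lambda>i. (f ^^ i) x)" for x
  have k: "k > 0"
    using assms(2) by (simp add: prime_gt_0_nat)
  have orb_sub: "orb y \<subseteq> orb x" if "y \<in> orb x" for x y
    using that by (auto simp: orb_def simp flip: funpow_add[unfolded o_def, THEN fun_cong])
  have orb_sym: "x \<in> orb y" if "y \<in> orb x" "x \<in> S" for x y
  proof -
    obtain i where i: "y = (f ^^ i) x"
      using \<open>y \<in> orb x\<close> by (auto simp: orb_def)
    have "(f ^^ (i * (k - 1))) y = (f ^^ (i * (k - 1) + i)) x"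
      by (simp add: i funpow_add)
    also have "i * (k - 1) + i = k * i"
      using k by (cases k) auto
    also have "(f ^^ (k * i)) x = x"
      using funpow_mod_eq[OF per[OF that(2)], of "k * i"] by simp
    finally show ?thesis
      unfolding orb_def by (metis rangeI)
  qed
  have orb_S: "orb x \<subseteq> S" if "x \<in> S" for x
    using funpow_in[OF f that] by (auto simp: orb_def)
  have orb_eq: "orb y = orb x" if "y \<in> orb x" "x \<in> S" for x y
    using orb_sub orb_sym[OF that] that by (meson subset_antisym)
  have card_orb: "card (orb x) = k" if x: "x \<in> S" for x
  proof -
    have "orb x = (\<lambda>i. (f ^^ i) x) ` {..<k}"
    proof (intro equalityI subsetI)
      fix y assume "y \<in> orb x"
      then obtain i where "y = (f ^^ (i mod k)) x"
        using funpow_mod_eq[OF per[OF x]] by (auto simp: orb_def)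
      then show "y \<in> (\<lambda>i. (f ^^ i) x) ` {..<k}"
        using k by auto
    qed (auto simp: orb_def)
    moreover have "inj_on (\<lambda>i. (f ^^ i) x) {..<k}"
    proof (rule linorder_inj_onI)
      fix i j assume ij: "i < j" "j \<in> {..<k}"
      define z where "z = (f ^^ i) x"
      have z: "z \<in> S"
        unfolding z_def by (rule funpow_in[OF f x])
      have "(f ^^ (j - i)) z \<noteq> z"
        using fixed_if_power_fixed[OF assms(2) per[OF z], of "j - i"] free[OF z] ij
        by (auto simp: less_imp_diff_less)
      moreover have "(f ^^ (j - i)) z = (f ^^ j) x"
        using ij by (simp add: z_def flip: funpow_add[unfolded o_def, THEN fun_cong])
      ultimately show "(f ^^ i) x \<noteq> (f ^^ j) x"
        by (simp add: z_def)
    qed auto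
    ultimately show ?thesis
      by (simp add: card_image)
  qed
  have S: "\<Union> (orb ` S) = S"
  proof -
    have "x \<in> orb x" for x
      unfolding orb_def by (metis funpow_0 rangeI)
    then show ?thesis
      using orb_S by blast
  qed
  have "k dvd card (\<Union> (orb ` S))"
  proof (rule dvd_partition)
    show "\<forall>c1\<in>orb ` S. \<forall>c2\<in>orb ` S. c1 \<noteq> c2 \<longrightarrow> c1 \<inter> c2 = {}"
      using orb_eq by blast
  qed (use S assms(1) card_orb in auto)
  then show ?thesis
    by (simp add: S)
qed

section \<open>Fixed-point-free automorphisms of prime order\<close>

text \<open>The identity automorphism of the trivial group is an instance, which provides the neutral
  element for products.  On a nontrivial group \<open>\<omega>\<close> has order exactly \<open>k\<close>.\<close>

locale fpf_automorphism = group K for K (structure) +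
  fixes k :: nat and \<omega> :: "'a \<Rightarrow> 'a"
  assumes finite_carrier: "finite (carrier K)"
    and prime_k: "prime k"
    and hom: "\<omega> \<in> hom K K"
    and period: "x \<in> carrier K \<Longrightarrow> (\<omega> ^^ k) x = x"
    and fixed_point_free: "x \<in> carrier K \<Longrightarrow> \<omega> x = x \<Longrightarrow> x = \<one>"

lemma fpf_automorphism_image:
  fixes K (structure) and f :: "'a \<Rightarrow> 'b"
  assumes "fpf_automorphism K k \<omega>" and f: "inj_on f (carrier K)"
  shows "\<exists>(K' :: 'b monoid) \<omega>'. fpf_automorphism K' k \<omega>' \<and> carrier K' = f ` carrier K"
proof -
  interpret fpf_automorphism K k \<omega> by fact
  define g where "g = inv_into (carrier K) f"
  have gf [simp]: "g (f x) = x" if "x \<in> carrier K" for x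
    using f that by (simp add: g_def)
  define K' where "K' = \<lparr>carrier = f ` carrier K,
    monoid.mult = (\<lambda>x y. f (g x \<otimes> g y)), one = f \<one>\<rparr>"
  have w [simp]: "\<omega> x \<in> carrier K" if "x \<in> carrier K" for x
    using hom that by (auto simp: hom_def)
  have pw: "((f \<circ> \<omega> \<circ> g) ^^ n) (f x) = f ((\<omega> ^^ n) x)" if "x \<in> carrier K" for x n
  proof (induction n)
    case (Suc n)
    then show ?case
      using that funpow_in[of \<omega> "carrier K" x n] by auto
  qed auto
  have fpf: "fpf_automorphism K' k (f \<circ> \<omega> \<circ> g)"
  proof (rule fpf_automorphism.intro)
    show "group K'"
      by (rule groupI) (auto simp: K'_def m_assoc intro!: bexI[of _ "inv _"])
    show "fpf_automorphism_axioms K' k (f \<circ> \<omega> \<circ> g)"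
    proof
      show "finite (carrier K')" "prime k"
        using finite_carrier prime_k by (auto simp: K'_def)
      show "f \<circ> \<omega> \<circ> g \<in> hom K' K'"
        using hom by (auto simp: K'_def hom_def)
      show "((f \<circ> \<omega> \<circ> g) ^^ k) x = x" if "x \<in> carrier K'" for x
        using that period pw by (auto simp: K'_def)
      show "x = \<one>\<^bsub>K'\<^esub>" if "x \<in> carrier K'" "(f \<circ> \<omega> \<circ> g) x = x" for x
        using that fixed_point_free f by (auto simp: K'_def inj_on_eq_iff)
    qed
  qed
  then show ?thesis
    by (intro exI[of _ K'] exI[of _ "f \<circ> \<omega> \<circ> g"]) (simp add: K'_def)
qed

text \<open>Fixing the type \<open>nat\<close> lets groups on different types (products, function spaces) take part
  in one induction over orders.\<close>

definition fpf_order :: "nat \<Rightarrow> nat \<Rightarrow> bool" where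
  "fpf_order k n \<longleftrightarrow> (\<exists>(K :: nat monoid) \<omega>. fpf_automorphism K k \<omega> \<and> order K = n)"

lemma fpf_orderI:
  assumes "fpf_automorphism K k \<omega>"
  shows "fpf_order k (order K)"
proof -
  interpret fpf_automorphism K k \<omega> by fact
  obtain f :: "'a \<Rightarrow> nat" where f: "inj_on f (carrier K)"
    using finite_carrier finite_imp_inj_to_nat_seg by metis
  from fpf_automorphism_image[OF assms f] obtain K' :: "nat monoid" and \<omega>' where
    "fpf_automorphism K' k \<omega>'" "carrier K' = f ` carrier K"
    by blast
  then show ?thesis
    unfolding fpf_order_def
    by (intro exI[of _ K'] exI[of _ \<omega>']) (auto simp: order_def card_image f)
qed

lemma fpf_order_1:
  assumes "prime k"
  shows "fpf_order k 1"
proof -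
  let ?K = "\<lparr>carrier = {()}, monoid.mult = (\<lambda>_ _. ()), one = ()\<rparr>"
  have "group ?K"
    by (rule groupI) auto
  then have "fpf_automorphism ?K k id"
    using assms by (intro fpf_automorphism.intro fpf_automorphism_axioms.intro) (auto simp: hom_def)
  from fpf_orderI[OF this] show ?thesis
    by (simp add: order_def)
qed

lemma fpf_order_mult:
  assumes "fpf_order k m" "fpf_order k n"
  shows "fpf_order k (m * n)"
proof -
  obtain K :: "nat monoid" and \<alpha> where K: "fpf_automorphism K k \<alpha>" "order K = m"
    using assms by (auto simp: fpf_order_def)
  obtain L :: "nat monoid" and \<beta> where L: "fpf_automorphism L k \<beta>" "order L = n"
    using assms by (auto simp: fpf_order_def)
  interpret K: fpf_automorphism K k \<alpha> by fact
  interpret L: fpf_automorphism L k \<beta> by fact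
  have pw: "(map_prod \<alpha> \<beta> ^^ i) (x, y) = ((\<alpha> ^^ i) x, (\<beta> ^^ i) y)" for i x y
    by (induction i) auto
  have "fpf_automorphism (K \<times>\<times> L) k (map_prod \<alpha> \<beta>)"
  proof (rule fpf_automorphism.intro)
    show "group (K \<times>\<times> L)"
      by (intro DirProd_group K.group_axioms L.group_axioms)
    show "fpf_automorphism_axioms (K \<times>\<times> L) k (map_prod \<alpha> \<beta>)"
      using K.hom L.hom K.finite_carrier L.finite_carrier K.prime_k
      by unfold_locales
        (auto simp: pw K.period L.period K.fixed_point_free L.fixed_point_free hom_def)
  qed
  from fpf_orderI[OF this] show ?thesis
    using K L by (simp add: order_def card_cartesian_product)
qed

section \<open>Elementary abelian groups\<close>

abbreviation elementary_abelian :: "nat \<Rightarrow> nat \<Rightarrow> (nat \<Rightarrow> int) monoid" where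
  "elementary_abelian p e \<equiv> product_group {..<e} (\<lambda>_. integer_mod_group p)"

lemma order_elementary_abelian:
  "p > 0 \<Longrightarrow> order (elementary_abelian p e) = p ^ e"
  by (simp add: order_def card_PiE carrier_integer_mod_group)

text \<open>If \<open>w\<close> has a nonzero entry in position \<open>i\<close>, then replacing the \<open>i\<close>-th vector of the
  standard basis by \<open>w\<close> gives a basis again.  The automorphism sends the first basis vector
  to \<open>w\<close> and the others to the remaining ones.\<close>

lemma elementary_abelian_automorphism_to:
  fixes p e :: nat
  defines "E \<equiv> elementary_abelian p e"
  assumes p: "prime p" and w: "w \<in> carrier E" "w \<noteq> \<one>\<^bsub>E\<^esub>"
  shows "\<exists>\<alpha>\<in>auto E. \<alpha> (\<lambda>i\<in>{..<e}. if i = 0 then 1 else 0) = w"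
proof -
  have p0: "p > 1"
    using p by (rule prime_gt_1_nat)
  have carrier: "carrier E = {..<e} \<rightarrow>\<^sub>E {0..<int p}"
    using p0 by (simp add: E_def carrier_integer_mod_group)
  have wr: "w j \<in> {0..<int p}" if "j < e" for j
    using w that by (auto simp: carrier PiE_iff)
  obtain i where i: "i < e" "w i \<noteq> 0"
  proof -
    have "\<exists>i<e. w i \<noteq> 0"
    proof (rule ccontr)
      assume "\<not> ?thesis"
      then have "w = \<one>\<^bsub>E\<^esub>"
        using w(1) by (auto simp: E_def PiE_iff extensional_def fun_eq_iff)
      then show False
        using w(2) by simp
    qed
    then show ?thesis using that by blast
  qed
  \<comment> \<open>The transposition of \<open>0\<close> and \<open>i\<close> frees position \<open>i\<close>, where \<open>w\<close> replaces the unit vector.\<close>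
  define \<sigma> where "\<sigma> j = (if j = 0 then i else if j = i then 0 else j)" for j
  have \<sigma>: "\<sigma> j < e" "\<sigma> (\<sigma> j) = j" if "j < e" for j
    using that i by (auto simp: \<sigma>_def)
  have \<sigma>i: "\<sigma> j = 0 \<longleftrightarrow> j = i" for j
    by (auto simp: \<sigma>_def)
  \<comment> \<open>Automorphisms are required to be undefined outside the carrier.\<close>
  define \<alpha> where "\<alpha> x = (if x \<in> carrier E then
      (\<lambda>j\<in>{..<e}. (x 0 * w j + (if j = i then 0 else x (\<sigma> j))) mod int p) else undefined)" for x
  have \<alpha>: "\<alpha> x j = (x 0 * w j + (if j = i then 0 else x (\<sigma> j))) mod int p"
    if "x \<in> carrier E" "j < e" for x j
    using that by (simp add: \<alpha>_def)
  have cl: "\<alpha> x \<in> carrier E" if "x \<in> carrier E" for x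
    using that p0 by (auto simp: carrier \<alpha>_def)
  interpret E: group E
    by (simp add: E_def)
  have mult: "(x \<otimes>\<^bsub>E\<^esub> y) j = (x j + y j) mod int p" if "j < e" for x y j
    using that by (simp add: E_def)
  have ext: "x = y" if "x \<in> carrier E" "y \<in> carrier E" "\<And>j. j < e \<Longrightarrow> x j = y j" for x y
    using that by (intro PiE_ext[of x "{..<e}" "\<lambda>_. {0..<int p}" y]) (auto simp: carrier)
  have hom: "\<alpha> \<in> hom E E"
  proof (rule homI)
    fix x y assume xy: "x \<in> carrier E" "y \<in> carrier E"
    show "\<alpha> (x \<otimes>\<^bsub>E\<^esub> y) = \<alpha> x \<otimes>\<^bsub>E\<^esub> \<alpha> y"
    proof (rule ext)
      fix j assume j: "j < e"
      have e0: "0 < e"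
        using j by simp
      have "((x 0 + y 0) mod int p * w j + (if j = i then 0 else (x (\<sigma> j) + y (\<sigma> j)) mod int p)) mod int p
          = ((x 0 + y 0) * w j + (if j = i then 0 else (x (\<sigma> j) + y (\<sigma> j)))) mod int p"
        by (auto intro!: mod_add_cong simp: mod_mult_left_eq)
      also have "\<dots> = ((x 0 * w j + (if j = i then 0 else x (\<sigma> j))) mod int p
          + (y 0 * w j + (if j = i then 0 else y (\<sigma> j))) mod int p) mod int p"
        unfolding mod_add_eq by (simp add: algebra_simps)
      finally show "\<alpha> (x \<otimes>\<^bsub>E\<^esub> y) j = (\<alpha> x \<otimes>\<^bsub>E\<^esub> \<alpha> y) j"
        by (simp only: mult[OF j] mult[OF e0] mult[OF \<sigma>(1)[OF j]]
            \<alpha>[OF E.m_closed[OF xy] j] \<alpha>[OF xy(1) j] \<alpha>[OF xy(2) j])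
    qed (use xy cl in auto)
  qed (use cl in auto)
  \<comment> \<open>Coordinate \<open>i\<close> of the image is \<open>x\<^sub>0 w\<^sub>i\<close>, which forces \<open>x\<^sub>0 = 0\<close>; the other coordinates of
    the image are then the remaining entries of \<open>x\<close>.\<close>
  have ker: "x = \<one>\<^bsub>E\<^esub>" if x: "x \<in> carrier E" and "\<alpha> x = \<one>\<^bsub>E\<^esub>" for x
  proof -
    have xr: "0 \<le> x j" "x j < int p" if "j < e" for j
      using x that by (auto simp: carrier PiE_iff)
    have z: "\<alpha> x j = 0" if "j < e" for j
      using \<open>\<alpha> x = \<one>\<^bsub>E\<^esub>\<close> that by (simp add: E_def)
    have "int p dvd x 0 * w i"
      using z[OF i(1)] i x by (simp add: \<alpha> dvd_eq_mod_eq_0)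
    moreover have "\<not> int p dvd w i"
      using wr[OF i(1)] i(2) zdvd_not_zless[of "w i" "int p"] by auto
    ultimately have "int p dvd x 0"
      using p by (metis prime_dvd_multD prime_nat_int_transfer)
    then have x0: "x 0 = 0"
      using xr[of 0] i zdvd_not_zless[of "x 0" "int p"] by fastforce
    have "x j = 0" if j: "j < e" for j
    proof (cases "j = 0")
      case False
      then have "\<sigma> j \<noteq> i"
        using \<sigma>(2)[OF j] \<sigma>i by metis
      then show ?thesis
        using z[OF \<sigma>(1)[OF j]] x \<sigma>[OF j] x0 xr[OF j] by (simp add: \<alpha>)
    qed (use x0 in auto)
    then show ?thesis
      by (intro ext x) (auto simp: E_def)
  qed
  have inj: "inj_on \<alpha> (carrier E)"
  proof -
    interpret group_hom E E \<alpha>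
      by unfold_locales (fact hom)
    show ?thesis
      using ker by (intro trivial_ker_imp_inj) (auto simp: kernel_def)
  qed
  have fin: "finite (carrier E)"
    by (auto simp: carrier intro: finite_PiE)
  have bij: "\<alpha> ` carrier E = carrier E"
    using inj fin cl by (intro endo_inj_surj) auto
  have auto: "\<alpha> \<in> auto E"
    using hom inj bij by (auto simp: auto_def Bij_def bij_betw_def \<alpha>_def extensional_def)
  have e0: "0 < e"
    using i by simp
  have u: "(\<lambda>i\<in>{..<e}. if i = 0 then 1 else 0) \<in> carrier E" (is "?u \<in> _")
    using p0 by (auto simp: carrier)
  have "\<alpha> ?u = w"
  proof (rule ext)
    fix j assume j: "j < e"
    show "\<alpha> ?u j = w j"
      using j u e0 wr[OF j] \<sigma>(1)[OF j] by (auto simp: \<alpha> \<sigma>i)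
  qed (use u cl w in auto)
  then show ?thesis
    using auto by blast
qed

text \<open>Orbit-stabilizer: the orbit of a nonidentity element consists of all nonidentity
  elements.\<close>

lemma dvd_order_AutoGroup_elementary_abelian:
  fixes p e :: nat
  defines "E \<equiv> elementary_abelian p e"
  assumes p: "prime p" and e: "e > 0"
  shows "p ^ e - 1 dvd order (AutoGroup E)"
proof -
  have p0: "p > 1"
    using p by (rule prime_gt_1_nat)
  interpret E: group E
    by (simp add: E_def)
  interpret A: group "AutoGroup E"
    by (rule E.AutoGroup)
  let ?u = "\<lambda>i\<in>{..<e}. if i = 0 then 1 else (0::int)"
  have u: "?u \<in> carrier E"
    using p0 by (auto simp: E_def carrier_integer_mod_group)
  have u1: "?u \<noteq> \<one>\<^bsub>E\<^esub>"
  proof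
    assume "?u = \<one>\<^bsub>E\<^esub>"
    then have "?u 0 = \<one>\<^bsub>E\<^esub> 0"
      by simp
    then show False
      using e by (simp add: E_def)
  qed
  interpret act: group_action "AutoGroup E" "carrier E" "\<lambda>\<alpha>. \<alpha>"
  proof (rule group_action.intro, rule group_hom.intro)
    show "group_hom_axioms (AutoGroup E) (BijGroup (carrier E)) (\<lambda>\<alpha>. \<alpha>)"
      by unfold_locales (auto simp: AutoGroup_def BijGroup_def auto_def hom_def)
  qed (auto simp: group_BijGroup A.group_axioms)
  have "orbit (AutoGroup E) (\<lambda>\<alpha>. \<alpha>) ?u = carrier E - {\<one>\<^bsub>E\<^esub>}"
  proof (intro equalityI subsetI)
    fix w assume "w \<in> orbit (AutoGroup E) (\<lambda>\<alpha>. \<alpha>) ?u"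
    then obtain \<alpha> where \<alpha>: "\<alpha> \<in> auto E" "w = \<alpha> ?u"
      by (auto simp: orbit_def AutoGroup_def)
    have "inj_on \<alpha> (carrier E)" "\<alpha> \<in> hom E E" "\<alpha> \<in> carrier E \<rightarrow> carrier E"
      using \<alpha> by (auto simp: auto_def Bij_def bij_betw_def)
    then show "w \<in> carrier E - {\<one>\<^bsub>E\<^esub>}"
      using u u1 \<alpha>(2) hom_one[OF _ E.group_axioms E.group_axioms, of \<alpha>]
      by (metis DiffI E.one_closed PiE inj_on_contraD singletonD)
  next
    fix w assume "w \<in> carrier E - {\<one>\<^bsub>E\<^esub>}"
    then show "w \<in> orbit (AutoGroup E) (\<lambda>\<alpha>. \<alpha>) ?u"
      using elementary_abelian_automorphism_to[OF p, of w e]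
      by (force simp: orbit_def AutoGroup_def E_def)
  qed
  then have "card (orbit (AutoGroup E) (\<lambda>\<alpha>. \<alpha>) ?u) = p ^ e - 1"
    using order_elementary_abelian[of p e] p0 by (simp add: order_def E_def card_Diff_singleton)
  then show ?thesis
    using act.orbit_stabilizer_theorem[OF u] by (metis dvd_triv_left)
qed

text \<open>An automorphism of order \<open>k\<close> supplied by Sylow's theorem may have nontrivial fixed points,
  for example when \<open>k\<close> divides \<open>p - 1\<close> already.  Then counting the elements that it moves
  splits \<open>e\<close> into two smaller exponents that satisfy the same divisibility.\<close>

lemma fpf_order_prime_power:
  assumes p: "prime p" and k: "prime k" and "k dvd p ^ e - 1"
  shows "fpf_order k (p ^ e)"
  using assms(3)
proof (induction e rule: less_induct)
  case (less e)
  show ?case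
  proof (cases "e = 0")
    case True
    then show ?thesis using fpf_order_1[OF k] by simp
  next
    case e: False
    define E where "E = elementary_abelian p e"
    have p0: "p > 1"
      using p by (rule prime_gt_1_nat)
    have pe: "p ^ e > 1"
      using p0 e by (metis one_less_power neq0_conv)
    interpret E: group E
      by (simp add: E_def)
    interpret A: group "AutoGroup E"
      by (rule E.AutoGroup)
    have orderE: "order E = p ^ e"
      using p0 by (simp add: E_def order_elementary_abelian)
    have finE: "finite (carrier E)"
      using orderE pe by (metis E.order_gt_0_iff_finite gr0I not_less_zero)
    have finA: "finite (carrier (AutoGroup E))"
    proof (rule finite_subset)
      show "carrier (AutoGroup E) \<subseteq> carrier E \<rightarrow>\<^sub>E carrier E"
        by (auto simp: AutoGroup_def auto_def hom_def Bij_def PiE_def)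
    qed (use finE in \<open>auto intro: finite_PiE\<close>)
    have "k dvd order (AutoGroup E)"
      using dvd_order_AutoGroup_elementary_abelian[OF p, of e] e less.prems
      by (auto simp: E_def intro: dvd_trans)
    then obtain m where "order (AutoGroup E) = k ^ 1 * m"
      by auto
    from sylow_thm[OF k A.group_axioms this finA] obtain S
      where S: "subgroup S (AutoGroup E)" "card S = k"
      by auto
    interpret S: subgroup S "AutoGroup E" by fact
    have "S \<noteq> {\<one>\<^bsub>AutoGroup E\<^esub>}"
      using S(2) k by (auto simp: prime_nat_iff)
    then obtain \<alpha> where \<alpha>: "\<alpha> \<in> S" "\<alpha> \<noteq> \<one>\<^bsub>AutoGroup E\<^esub>"
      using S.one_closed by blast
    have hom: "\<alpha> \<in> hom E E" and ext: "\<alpha> \<in> extensional (carrier E)"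
      using S.mem_carrier[OF \<alpha>(1)] by (auto simp: AutoGroup_def auto_def Bij_def)
    interpret group_hom E E \<alpha>
      by unfold_locales (fact hom)
    \<comment> \<open>In the automorphism group, powers are restricted to the carrier, hence agree with
      iterates only there.\<close>
    have pow: "(\<alpha> [^]\<^bsub>AutoGroup E\<^esub> n) x = (\<alpha> ^^ n) x" if "x \<in> carrier E" for n :: nat and x
      using that
    proof (induction n arbitrary: x)
      case 0
      then show ?case by (simp add: AutoGroup_def BijGroup_def)
    next
      case (Suc n)
      have "\<alpha> \<in> Bij (carrier E)" "\<alpha> [^]\<^bsub>AutoGroup E\<^esub> n \<in> Bij (carrier E)"
        using A.nat_pow_closed[OF S.mem_carrier[OF \<alpha>(1)], of n] S.mem_carrier[OF \<alpha>(1)]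
        by (auto simp: AutoGroup_def auto_def)
      then have "(\<alpha> [^]\<^bsub>AutoGroup E\<^esub> Suc n) x = (\<alpha> [^]\<^bsub>AutoGroup E\<^esub> n) (\<alpha> x)"
        using Suc.prems by (simp add: AutoGroup_def BijGroup_def compose_def)
      then show ?case
        using Suc by (simp add: funpow_swap1)
    qed
    have period: "(\<alpha> ^^ k) x = x" if "x \<in> carrier E" for x
    proof -
      interpret SG: group "AutoGroup E\<lparr>carrier := S\<rparr>"
        using S(1) A.group_axioms by (rule subgroup.subgroup_is_group)
      have "\<alpha> [^]\<^bsub>AutoGroup E\<lparr>carrier := S\<rparr>\<^esub> k = \<one>\<^bsub>AutoGroup E\<^esub>"
        using SG.pow_order_eq_1[of \<alpha>] \<alpha>(1) S(2) by (simp add: order_def)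
      then have "\<alpha> [^]\<^bsub>AutoGroup E\<^esub> k = \<one>\<^bsub>AutoGroup E\<^esub>"
        by (simp add: nat_pow_def)
      then show ?thesis
        using pow[OF that, of k] that by (simp add: AutoGroup_def BijGroup_def)
    qed
    define F where "F = {x \<in> carrier E. \<alpha> x = x}"
    have "subgroup F E"
      by (rule E.subgroupI) (auto simp: F_def)
    then have "card F dvd p ^ e"
      using E.lagrange orderE by (metis dvd_triv_right)
    then obtain f where f: "f \<le> e" "card F = p ^ f"
      using p by (auto simp: divides_primepow_nat)
    have "f \<noteq> e"
    proof
      assume "f = e"
      then have "F = carrier E"
        using f orderE finE by (intro card_subset_eq) (auto simp: F_def order_def)
      then have "\<alpha> = \<one>\<^bsub>AutoGroup E\<^esub>"
        using ext by (auto simp: F_def AutoGroup_def BijGroup_def extensional_def fun_eq_iff)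
      then show False
        using \<alpha>(2) by simp
    qed
    then have fe: "f < e"
      using f by simp
    have inj: "inj_on \<alpha> (carrier E)"
      using S.mem_carrier[OF \<alpha>(1)] by (auto simp: AutoGroup_def auto_def Bij_def bij_betw_def)
    have "k dvd card (carrier E - F)"
      using k finE period inj
      by (intro prime_period_dvd_card[of _ k \<alpha>]) (auto simp: F_def inj_on_eq_iff)
    also have "card (carrier E - F) = p ^ e - p ^ f"
      using finE f orderE by (subst card_Diff_subset) (auto simp: F_def order_def finite_subset)
    finally have kf: "k dvd p ^ e - p ^ f" .
    show ?thesis
    proof (cases "f = 0")
      case True
      have "x = \<one>\<^bsub>E\<^esub>" if "x \<in> carrier E" "\<alpha> x = x" for x
      proof -
        have "card F = 1"
          using f True by simp
        moreover have "x \<in> F" "\<one>\<^bsub>E\<^esub> \<in> F"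
          using that by (auto simp: F_def)
        ultimately show ?thesis
          by (metis card_1_singletonE singletonD)
      qed
      then have "fpf_automorphism E k \<alpha>"
        using finE k hom period
        by (intro fpf_automorphism.intro fpf_automorphism_axioms.intro E.group_axioms)
      from fpf_orderI[OF this] show ?thesis
        by (simp add: orderE)
    next
      case False
      have pf: "p ^ f > 0" "p ^ f \<le> p ^ e"
        using p0 fe by (auto intro: power_increasing)
      have "k dvd (p ^ e - 1) - (p ^ e - p ^ f)"
        using less.prems kf by (rule dvd_diff_nat)
      also have "(p ^ e - 1) - (p ^ e - p ^ f) = p ^ f - 1"
        using pf by simp
      finally have k1: "k dvd p ^ f - 1" .
      have "p ^ e - p ^ f = p ^ f * (p ^ (e - f) - 1)"
        using fe by (simp add: diff_mult_distrib2 flip: power_add)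
      moreover have "\<not> k dvd p ^ f"
        using k1 pf k by (metis Suc_diff_1 dvd_add_right_iff not_prime_unit plus_1_eq_Suc add.commute)
      ultimately have k2: "k dvd p ^ (e - f) - 1"
        using kf k by (metis prime_dvd_mult_iff)
      have "fpf_order k (p ^ f * p ^ (e - f))"
        using less.IH[OF fe k1] less.IH[OF _ k2] False fe by (intro fpf_order_mult) auto
      then show ?thesis
        using fe by (simp flip: power_add)
    qed
  qed
qed

lemma fpf_order_prod:
  assumes "prime k" "\<And>i. i \<in> I \<Longrightarrow> fpf_order k (n i)"
  shows "fpf_order k (\<Prod>i\<in>I. n i)"
  using assms(2)
  by (induction I rule: infinite_finite_induct)
    (auto intro: fpf_order_mult fpf_order_1[OF assms(1), unfolded One_nat_def])

section \<open>The design of a fixed-point-free automorphism\<close>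

context fpf_automorphism
begin

lemma k_ge_2: "k \<ge> 2"
  using prime_k by (rule prime_ge_2_nat)

lemma funpow_closed [simp]: "x \<in> carrier K \<Longrightarrow> (\<omega> ^^ n) x \<in> carrier K"
  using hom by (intro funpow_in) (auto simp: hom_def)

lemma hom_funpow: "\<omega> ^^ n \<in> hom K K"
proof (induction n)
  case (Suc n)
  then show ?case
    using hom by (auto simp: hom_def Pi_iff)
qed (auto simp: hom_def)

lemma funpow_mult:
  "x \<in> carrier K \<Longrightarrow> y \<in> carrier K \<Longrightarrow> (\<omega> ^^ n) (x \<otimes> y) = (\<omega> ^^ n) x \<otimes> (\<omega> ^^ n) y"
  using hom_funpow by (rule hom_mult)

lemma funpow_mod: "x \<in> carrier K \<Longrightarrow> (\<omega> ^^ (n mod k)) x = (\<omega> ^^ n) x"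
  by (rule funpow_mod_eq) (rule period)

lemma funpow_funpow: "(\<omega> ^^ m) ((\<omega> ^^ n) x) = (\<omega> ^^ (m + n)) x"
  by (simp add: funpow_add)

lemma funpow_inverse:
  assumes "x \<in> carrier K" "i \<le> k"
  shows "(\<omega> ^^ i) ((\<omega> ^^ (k - i)) x) = x" "(\<omega> ^^ (k - i)) ((\<omega> ^^ i) x) = x"
  using assms period by (simp_all add: funpow_funpow)

lemma funpow_eq_one_iff:
  assumes "x \<in> carrier K"
  shows "(\<omega> ^^ n) x = \<one> \<longleftrightarrow> x = \<one>"
proof
  have one: "(\<omega> ^^ m) \<one> = \<one>" for m
    using hom_funpow by (rule hom_one) (rule group_axioms)+
  show "(\<omega> ^^ n) x = \<one>" if "x = \<one>"
    using that one by simp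
  assume "(\<omega> ^^ n) x = \<one>"
  then have "(\<omega> ^^ (n mod k)) x = \<one>"
    by (simp add: funpow_mod assms)
  then have "(\<omega> ^^ (k - n mod k)) ((\<omega> ^^ (n mod k)) x) = \<one>"
    by (simp add: one)
  then show "x = \<one>"
    using funpow_inverse(2)[OF assms, of "n mod k"] k_ge_2 by (simp add: less_imp_le)
qed

lemma funpow_fixed_point_free:
  assumes "0 < t" "t < k" "x \<in> carrier K" "(\<omega> ^^ t) x = x"
  shows "x = \<one>"
  using fixed_if_power_fixed[OF prime_k period _ assms(1,2)] assms fixed_point_free by blast

text \<open>If \<open>y\<close> and \<open>z\<close> have the same displacement, then \<open>\<omega>\<^sup>t\<close> fixes \<open>z y\<^sup>-\<^sup>1\<close>.  By finiteness,
  injectivity is enough.  The order of the factors matters because \<open>K\<close> may be nonabelian: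
  displacements are quotients from the left, as the blocks are translated from the left.\<close>

lemma displacement_bij:
  assumes t: "0 < t" "t < k"
  shows "bij_betw (\<lambda>z. inv z \<otimes> (\<omega> ^^ t) z) (carrier K) (carrier K)" (is "bij_betw ?d _ _")
proof -
  have inj: "inj_on ?d (carrier K)"
  proof (rule inj_onI)
    fix y z assume yz: "y \<in> carrier K" "z \<in> carrier K" and eq: "?d y = ?d z"
    let ?x = "z \<otimes> inv y"
    have "(\<omega> ^^ t) ?x \<otimes> (\<omega> ^^ t) y = (\<omega> ^^ t) z"
      using yz by (simp add: m_assoc flip: funpow_mult)
    also have "\<dots> = z \<otimes> ?d z"
      using yz by (simp flip: m_assoc)
    also have "\<dots> = z \<otimes> ?d y"
      by (simp only: eq)
    also have "\<dots> = ?x \<otimes> (\<omega> ^^ t) y"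
      using yz by (simp add: m_assoc)
    finally have "(\<omega> ^^ t) ?x = ?x"
      using yz by simp
    then have "?x = \<one>"
      using yz by (intro funpow_fixed_point_free[OF t]) auto
    then have "z \<otimes> inv y \<otimes> y = y"
      using yz by simp
    then show "y = z"
      using yz by (simp add: m_assoc)
  qed
  moreover have "?d ` carrier K = carrier K"
    using inj finite_carrier by (intro endo_inj_surj) auto
  ultimately show ?thesis
    by (simp add: bij_betw_def)
qed

definition base_list :: "'a \<Rightarrow> 'a \<Rightarrow> 'a list" where
  "base_list x y = map (\<lambda>i. x \<otimes> (\<omega> ^^ i) y) [0..<k]"

definition block :: "'a \<Rightarrow> 'a \<Rightarrow> 'a list set" where
  "block x y = cyc (base_list x y)"

definition parallel_class :: "'a \<Rightarrow> 'a list set set" where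
  "parallel_class x = block x ` (carrier K - {\<one>})"

definition blocks :: "'a list set set" where
  "blocks = (\<Union>x\<in>carrier K. parallel_class x)"

lemma length_base_list [simp]: "length (base_list x y) = k"
  by (simp add: base_list_def)

lemma nth_base_list [simp]: "i < k \<Longrightarrow> base_list x y ! i = x \<otimes> (\<omega> ^^ i) y"
  by (simp add: base_list_def)

lemma rotate_base_list:
  assumes "x \<in> carrier K" "y \<in> carrier K"
  shows "rotate n (base_list x y) = base_list x ((\<omega> ^^ n) y)"
proof (rule nth_equalityI)
  fix i assume "i < length (rotate n (base_list x y))"
  then have i: "i < k"
    by simp
  then have "rotate n (base_list x y) ! i = x \<otimes> (\<omega> ^^ ((n + i) mod k)) y"
    by (simp add: nth_rotate)
  also have "\<dots> = x \<otimes> (\<omega> ^^ i) ((\<omega> ^^ n) y)"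
    using assms by (simp add: funpow_mod funpow_funpow add.commute)
  finally show "rotate n (base_list x y) ! i = base_list x ((\<omega> ^^ n) y) ! i"
    using i by simp
qed simp

lemma distinct_base_list:
  assumes "x \<in> carrier K" "y \<in> carrier K" "y \<noteq> \<one>"
  shows "distinct (base_list x y)"
proof -
  have "(\<omega> ^^ i) y \<noteq> (\<omega> ^^ j) y" if "i < j" "j < k" for i j
  proof
    assume eq: "(\<omega> ^^ i) y = (\<omega> ^^ j) y"
    have "(\<omega> ^^ (j - i)) ((\<omega> ^^ i) y) = (\<omega> ^^ j) y"
      using that by (simp add: funpow_funpow)
    with eq have "(\<omega> ^^ (j - i)) ((\<omega> ^^ i) y) = (\<omega> ^^ i) y"
      by simp
    then show False
      using funpow_fixed_point_free[of "j - i" "(\<omega> ^^ i) y"] that assms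
      by (simp add: funpow_eq_one_iff less_imp_diff_less)
  qed
  then show ?thesis
    using assms by (simp add: distinct_conv_nth linorder_neq_iff) metis
qed

text \<open>Applying \<open>\<omega>\<close> to \<open>y\<close> rotates the list, so a block depends only on \<open>x\<close> and the
  \<open>\<omega>\<close>-orbit of \<open>y\<close>.\<close>

lemma block_funpow:
  assumes "x \<in> carrier K" "y \<in> carrier K"
  shows "block x ((\<omega> ^^ n) y) = block x y"
proof -
  have sub: "block x ((\<omega> ^^ n) z) \<subseteq> block x z" if "z \<in> carrier K" for n z
    using assms that
    by (auto simp: block_def cyc_def rotate_rotate simp flip: rotate_base_list)
  have "(\<omega> ^^ (k - n mod k)) ((\<omega> ^^ n) y) = y"
    using funpow_inverse(2)[OF assms(2), of "n mod k"] k_ge_2 assms(2)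
    by (simp add: funpow_mod less_imp_le)
  then have "block x y \<subseteq> block x ((\<omega> ^^ n) y)"
    using sub[of "(\<omega> ^^ n) y" "k - n mod k"] assms by simp
  then show ?thesis
    using sub[OF assms(2)] by blast
qed

lemma points_block: "points (block x y) = (\<lambda>i. x \<otimes> (\<omega> ^^ i) y) ` {..<k}"
  by (auto simp: points_def block_def cyc_def base_list_def)

lemma apart_block_iff:
  assumes "x \<in> carrier K" "y \<in> carrier K"
  shows "apart t (block x y) a b \<longleftrightarrow>
    (\<exists>i. a = x \<otimes> (\<omega> ^^ i) y \<and> b = x \<otimes> (\<omega> ^^ t) ((\<omega> ^^ i) y))" (is "?L \<longleftrightarrow> ?R")
proof
  assume ?L
  then obtain n i where i: "i < k" "a = base_list x ((\<omega> ^^ n) y) ! i"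
      "b = base_list x ((\<omega> ^^ n) y) ! ((i + t) mod k)"
    using assms by (auto simp: apart_def block_def cyc_def rotate_base_list)
  have "(\<omega> ^^ ((i + t) mod k)) ((\<omega> ^^ n) y) = (\<omega> ^^ t) ((\<omega> ^^ (i + n)) y)"
    using assms by (simp add: funpow_mod) (simp add: funpow_funpow ac_simps)
  then show ?R
    using i by (intro exI[of _ "i + n"]) (simp add: funpow_add)
next
  assume ?R
  then obtain i where "a = x \<otimes> (\<omega> ^^ i) y" "b = x \<otimes> (\<omega> ^^ t) ((\<omega> ^^ i) y)"
    by blast
  then have "a = rotate i (base_list x y) ! 0"
      "b = rotate i (base_list x y) ! ((0 + t) mod length (rotate i (base_list x y)))"
    using assms k_ge_2 by (simp_all add: rotate_base_list funpow_mod)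
  then show ?L
    unfolding apart_def block_def cyc_def using k_ge_2 assms
    by (intro bexI[of _ "rotate i (base_list x y)"] exI[of _ 0]) auto
qed

lemma blocksE:
  assumes "B \<in> blocks"
  obtains x y where "x \<in> carrier K" "y \<in> carrier K" "y \<noteq> \<one>" "B = block x y"
  using assms by (auto simp: blocks_def parallel_class_def)

lemma blocksI:
  "x \<in> carrier K \<Longrightarrow> y \<in> carrier K \<Longrightarrow> y \<noteq> \<one> \<Longrightarrow> block x y \<in> blocks"
  by (auto simp: blocks_def parallel_class_def)

text \<open>The quotient \<open>a\<^sup>-\<^sup>1 b\<close> is free of \<open>x\<close>, and the generator \<open>y\<close> can be moved along its orbit so
  that \<open>a\<close> is the first entry of the list.\<close>

lemma apart_blockD:
  assumes "x \<in> carrier K" "y \<in> carrier K" "apart t (block x y) a b"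
  obtains z where "z \<in> carrier K" "block x y = block x z" "a = x \<otimes> z"
    "inv a \<otimes> b = inv z \<otimes> (\<omega> ^^ t) z"
proof -
  from assms obtain i where i: "a = x \<otimes> (\<omega> ^^ i) y" "b = x \<otimes> (\<omega> ^^ t) ((\<omega> ^^ i) y)"
    by (auto simp: apart_block_iff)
  let ?z = "(\<omega> ^^ i) y"
  have "inv a \<otimes> b = inv ?z \<otimes> (inv x \<otimes> (x \<otimes> (\<omega> ^^ t) ?z))"
    unfolding i using assms by (simp add: inv_mult_group m_assoc)
  also have "inv x \<otimes> (x \<otimes> (\<omega> ^^ t) ?z) = (\<omega> ^^ t) ?z"
    using assms by (simp flip: m_assoc)
  finally show ?thesis
    using that[of ?z] i assms by (simp add: block_funpow)
qed

text \<open>Bijectivity of the displacement gives both existence and uniqueness of the generator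
  \<open>z\<close>, and \<open>x = a z\<^sup>-\<^sup>1\<close>.\<close>

lemma ex1_block_apart:
  assumes t: "0 < t" "t < k" and ab: "a \<in> carrier K" "b \<in> carrier K" "a \<noteq> b"
  shows "\<exists>!B. B \<in> blocks \<and> apart t B a b"
proof -
  let ?d = "\<lambda>z. inv z \<otimes> (\<omega> ^^ t) z"
  have "inv a \<otimes> b \<in> ?d ` carrier K"
    using displacement_bij[OF t] ab by (simp add: bij_betw_def)
  then obtain z where z: "z \<in> carrier K" "inv a \<otimes> b = ?d z"
    by auto
  define x where "x = a \<otimes> inv z"
  have x: "x \<in> carrier K"
    using ab z by (simp add: x_def)
  have a: "a = x \<otimes> z"
    using ab z by (simp add: x_def m_assoc)
  have "b = a \<otimes> (inv a \<otimes> b)"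
    using ab by (simp flip: m_assoc)
  also have "\<dots> = x \<otimes> (\<omega> ^^ t) z"
    unfolding z(2) using ab z by (simp add: x_def m_assoc)
  finally have b: "b = x \<otimes> (\<omega> ^^ t) z" .
  have "z \<noteq> \<one>"
    using a b ab z(1) funpow_eq_one_iff[of \<one> t] by auto
  show ?thesis
  proof (rule ex1I)
    show "block x z \<in> blocks \<and> apart t (block x z) a b"
      using x z \<open>z \<noteq> \<one>\<close> a b by (auto simp: apart_block_iff intro!: blocksI exI[of _ 0])
  next
    fix B assume B: "B \<in> blocks \<and> apart t B a b"
    then obtain x' y' where xy: "x' \<in> carrier K" "y' \<in> carrier K" "B = block x' y'"
      by (auto elim: blocksE)
    from xy B obtain z' where z': "z' \<in> carrier K" "B = block x' z'" "a = x' \<otimes> z'"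
        "inv a \<otimes> b = ?d z'"
      using apart_blockD[of x' y' t a b] by metis
    have "z' = z"
      by (rule inj_onD[OF bij_betw_imp_inj_on[OF displacement_bij[OF t]]
            trans[OF z'(4)[symmetric] z(2)] z'(1) z(1)])
    moreover have "x' = x"
    proof -
      have "x' \<otimes> z = x \<otimes> z"
        using a z'(3) \<open>z' = z\<close> by metis
      then show ?thesis
        using right_cancel[OF z(1) xy(1) x] by blast
    qed
    ultimately show "B = block x z"
      by (simp only: z'(2))
  qed
qed

lemma blocks_cyclic: "blocks \<subseteq> cyclic_k_subsets k (carrier K)"
proof
  fix B assume "B \<in> blocks"
  then obtain x y where "x \<in> carrier K" "y \<in> carrier K" "y \<noteq> \<one>" "B = block x y"
    by (rule blocksE)
  then show "B \<in> cyclic_k_subsets k (carrier K)"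
    unfolding cyclic_k_subsets_def block_def
    using distinct_base_list by (auto simp: set_conv_nth intro!: exI[of _ "base_list x y"])
qed

lemma points_disjoint:
  assumes "x \<in> carrier K" "B \<in> parallel_class x" "C \<in> parallel_class x" "B \<noteq> C"
  shows "points B \<inter> points C = {}"
proof (rule ccontr)
  assume "\<not> ?thesis"
  moreover obtain y z where yz: "y \<in> carrier K" "z \<in> carrier K" "B = block x y" "C = block x z"
    using assms by (auto simp: parallel_class_def)
  ultimately obtain i j where "x \<otimes> (\<omega> ^^ i) y = x \<otimes> (\<omega> ^^ j) z"
    by (auto simp: points_block)
  then have "(\<omega> ^^ i) y = (\<omega> ^^ j) z"
    using assms(1) yz by simp
  then have "block x y = block x z"
    using block_funpow assms(1) yz by metis
  then show False
    using assms(4) yz by simp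
qed

lemma card_points:
  assumes "B \<in> blocks"
  shows "card (points B) = k"
proof -
  obtain x y where xy: "x \<in> carrier K" "y \<in> carrier K" "y \<noteq> \<one>" "B = block x y"
    using assms by (rule blocksE)
  have "points B = set (base_list x y)"
    by (auto simp: xy points_block base_list_def)
  then show ?thesis
    using distinct_base_list[OF xy(1-3)] by (simp add: distinct_card)
qed

lemma Union_points:
  assumes x: "x \<in> carrier K"
  shows "\<Union> (points ` parallel_class x) = carrier K - {x}"
proof (intro equalityI subsetI)
  fix a assume "a \<in> \<Union> (points ` parallel_class x)"
  then obtain y i where y: "y \<in> carrier K" "y \<noteq> \<one>" "a = x \<otimes> (\<omega> ^^ i) y"
    by (auto simp: parallel_class_def points_block)
  then show "a \<in> carrier K - {x}"
    using x by (simp add: funpow_eq_one_iff)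
next
  fix a assume a: "a \<in> carrier K - {x}"
  let ?y = "inv x \<otimes> a"
  have "?y \<in> carrier K" "a = x \<otimes> ?y"
    using a x by (simp_all flip: m_assoc)
  moreover from this have "?y \<noteq> \<one>"
    using a x by (metis DiffE r_one singletonI)
  moreover have "a \<in> points (block x ?y)"
    using \<open>a = x \<otimes> ?y\<close> k_ge_2 by (auto simp: points_block intro!: image_eqI[of _ _ 0])
  ultimately show "a \<in> \<Union> (points ` parallel_class x)"
    by (auto simp: parallel_class_def)
qed

text \<open>The blocks of a class have \<open>k\<close> points each and together cover every point except \<open>x\<close>.
  In particular \<open>k\<close> divides \<open>order K - 1\<close>, which puts the design in the second case of
  resolvability.\<close>

lemma card_parallel_class:
  assumes x: "x \<in> carrier K"
  shows "k * card (parallel_class x) = order K - 1"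
proof -
  have "card (\<Union> (points ` parallel_class x)) = (\<Sum>B\<in>parallel_class x. card (points B))"
  proof (rule card_UN_disjoint)
    show "finite (parallel_class x)"
      using finite_carrier by (simp add: parallel_class_def)
    show "\<forall>B\<in>parallel_class x. finite (points B)"
      by (auto simp: parallel_class_def points_block)
  qed (use points_disjoint[OF x] in auto)
  also have "\<dots> = card (parallel_class x) * k"
  proof -
    have "card (points B) = k" if "B \<in> parallel_class x" for B
      using card_points x that by (auto simp: blocks_def)
    then show ?thesis
      by simp
  qed
  finally show ?thesis
    using x by (simp add: Union_points order_def mult.commute card_Diff_singleton)
qed

text \<open>A block determines \<open>x\<close>: take two consecutive points \<open>a\<close>, \<open>b\<close> of it.  Their quotient
  determines the generator \<open>z\<close>, and \<open>x = a z\<^sup>-\<^sup>1\<close>.\<close>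

lemma parallel_class_disjoint:
  assumes x: "x \<in> carrier K" "x' \<in> carrier K" "x \<noteq> x'"
  shows "parallel_class x \<inter> parallel_class x' = {}"
proof (rule ccontr)
  assume "\<not> ?thesis"
  then obtain B where B: "B \<in> parallel_class x" "B \<in> parallel_class x'"
    by blast
  obtain y where y: "y \<in> carrier K" "B = block x y"
    using B by (auto simp: parallel_class_def)
  obtain y' where y': "y' \<in> carrier K" "B = block x' y'"
    using B by (auto simp: parallel_class_def)
  have k: "0 < (1::nat)" "1 < k"
    using k_ge_2 by auto
  have ap: "apart 1 B (x \<otimes> y) (x \<otimes> (\<omega> ^^ 1) y)"
    using x y by (auto simp: apart_block_iff intro!: exI[of _ 0])
  from ap y x obtain z where z: "z \<in> carrier K" "x \<otimes> y = x \<otimes> z"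
      "inv (x \<otimes> y) \<otimes> (x \<otimes> (\<omega> ^^ 1) y) = inv z \<otimes> (\<omega> ^^ 1) z"
    using apart_blockD[of x y 1] by metis
  from ap y' x obtain z' where z': "z' \<in> carrier K" "x \<otimes> y = x' \<otimes> z'"
      "inv (x \<otimes> y) \<otimes> (x \<otimes> (\<omega> ^^ 1) y) = inv z' \<otimes> (\<omega> ^^ 1) z'"
    using apart_blockD[of x' y' 1] by metis
  have "z = z'"
    using inj_onD[OF bij_betw_imp_inj_on[OF displacement_bij[OF k]], of z z'] z z' by simp
  then show False
    using z z' x by simp
qed

text \<open>The parallel classes, indexed by the point that each one misses, form the resolution.\<close>

theorem design_rpmd:
  assumes "order K > 1"
  shows "rpmd (order K) k (carrier K) blocks"
proof -
  have k: "k * card (parallel_class \<one>) = order K - 1"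
    by (rule card_parallel_class) simp
  then have ord: "order K = k * card (parallel_class \<one>) + 1"
    using assms by simp
  have c0: "card (parallel_class \<one>) > 0"
    using ord assms by (intro gr0I) auto
  have "k \<le> k * card (parallel_class \<one>)"
    using c0 by simp
  then have le: "k \<le> order K"
    using ord by linarith
  have md: "mendelsohn_design (order K) k (carrier K) blocks"
    unfolding mendelsohn_design_def
    using le finite_carrier k_ge_2 blocks_cyclic ex1_block_apart[of 1] by (simp add: order_def)
  have "perfect_md (order K) k (carrier K) blocks"
    unfolding perfect_md_def
    using md k_ge_2 by (intro conjI ballI impI ex1_block_apart) auto
  moreover have "order K mod k = 1"
    using k_ge_2 by (subst ord, subst mod_mult_self4) simp
  moreover have "block_partition (order K) ((order K - 1) div k) blocks"
  proof -
    have card: "card (parallel_class x) = (order K - 1) div k" if "x \<in> carrier K" for x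
      using k_ge_2 by (subst card_parallel_class[OF that, symmetric]) simp
    have ne: "parallel_class x \<noteq> {}" if "x \<in> carrier K" for x
      using card_parallel_class[OF that] assms by auto
    have "inj_on parallel_class (carrier K)"
      using parallel_class_disjoint ne by (intro inj_onI) (metis Int_absorb)
    then have "card (parallel_class ` carrier K) = order K"
      by (simp add: card_image order_def)
    moreover have "partition_on blocks (parallel_class ` carrier K)"
    proof (rule partition_onI)
      show "{} \<notin> parallel_class ` carrier K"
        using ne by blast
    qed (use parallel_class_disjoint in \<open>auto simp: blocks_def disjnt_def\<close>)
    moreover have "finite (parallel_class x)" "disjoint_family_on points (parallel_class x)"
      if "x \<in> carrier K" for x
      using points_disjoint[OF that] finite_carrier
      by (auto simp: disjoint_family_on_def parallel_class_def)
    ultimately show ?thesis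
      unfolding block_partition_def
      using finite_carrier card by (intro exI[of _ "parallel_class ` carrier K"]) auto
  qed
  ultimately show ?thesis
    using md by (simp add: rpmd_def resolvable_md_def)
qed

section \<open>The Frobenius group and its action\<close>

definition cyclic_complement :: "nat monoid" where
  "cyclic_complement = \<lparr>carrier = {..<k}, monoid.mult = (\<lambda>a b. (a + b) mod k), one = 0\<rparr>"

text \<open>Both actions are restricted to the carrier because the elements of the groups of
  automorphisms and of bijections are extensional functions.\<close>

definition complement_action :: "nat \<Rightarrow> 'a \<Rightarrow> 'a" where
  "complement_action i = restrict (\<omega> ^^ i) (carrier K)"

definition affine_action :: "'a \<times> nat \<Rightarrow> 'a \<Rightarrow> 'a" where
  "affine_action = (\<lambda>(x, i). \<lambda>z\<in>carrier K. x \<otimes> (\<omega> ^^ i) z)"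

lemma group_cyclic_complement: "group cyclic_complement"
proof (rule groupI)
  fix x assume "x \<in> carrier cyclic_complement"
  then show "\<exists>y\<in>carrier cyclic_complement.
      y \<otimes>\<^bsub>cyclic_complement\<^esub> x = \<one>\<^bsub>cyclic_complement\<^esub>"
    using k_ge_2 by (intro bexI[of _ "(k - x) mod k"]) (auto simp: cyclic_complement_def mod_simps)
qed (use k_ge_2 in \<open>auto simp: cyclic_complement_def mod_simps add.assoc\<close>)

lemma order_cyclic_complement: "order cyclic_complement = k"
  by (simp add: order_def cyclic_complement_def)

lemma bij_affine:
  assumes "x \<in> carrier K" "i < k"
  shows "bij_betw (\<lambda>z. x \<otimes> (\<omega> ^^ i) z) (carrier K) (carrier K)"
proof (rule bij_betw_byWitness[where f' = "\<lambda>z. (\<omega> ^^ (k - i)) (inv x \<otimes> z)"])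
  show "\<forall>z\<in>carrier K. (\<omega> ^^ (k - i)) (inv x \<otimes> (x \<otimes> (\<omega> ^^ i) z)) = z"
    using assms by (auto simp: funpow_inverse simp flip: m_assoc)
  show "\<forall>z\<in>carrier K. x \<otimes> (\<omega> ^^ i) ((\<omega> ^^ (k - i)) (inv x \<otimes> z)) = z"
    using assms by (auto simp: funpow_inverse simp flip: m_assoc)
qed (use assms in auto)

lemma frobenius_complement:
  assumes "order K > 1"
  shows "frobenius K cyclic_complement complement_action"
proof -
  have auto: "complement_action i \<in> auto K" if "i < k" for i
  proof -
    have "restrict (\<omega> ^^ i) (carrier K) \<in> hom K K"
      using hom_funpow[of i] by (auto simp: hom_def)
    moreover have "bij_betw (restrict (\<omega> ^^ i) (carrier K)) (carrier K) (carrier K)"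
    proof (subst bij_betw_cong)
      show "bij_betw (\<lambda>z. \<one> \<otimes> (\<omega> ^^ i) z) (carrier K) (carrier K)"
        by (rule bij_affine[OF one_closed that])
    qed auto
    ultimately show ?thesis
      by (simp add: auto_def Bij_def complement_action_def)
  qed
  have "group_hom cyclic_complement (AutoGroup K) complement_action"
  proof (rule group_hom.intro[OF group_cyclic_complement AutoGroup], unfold_locales, rule homI)
    fix i j assume "i \<in> carrier cyclic_complement" "j \<in> carrier cyclic_complement"
    then have ij: "i < k" "j < k"
      by (simp_all add: cyclic_complement_def)
    then have "complement_action i \<in> Bij (carrier K)" "complement_action j \<in> Bij (carrier K)"
      using auto by (auto simp: auto_def)
    then show "complement_action (i \<otimes>\<^bsub>cyclic_complement\<^esub> j) =
        complement_action i \<otimes>\<^bsub>AutoGroup K\<^esub> complement_action j"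
      by (auto simp: AutoGroup_def BijGroup_def cyclic_complement_def complement_action_def
          compose_def fun_eq_iff funpow_mod funpow_funpow)
  qed (auto simp: cyclic_complement_def AutoGroup_def auto)
  moreover have "carrier K \<noteq> {\<one>}"
    using assms by (auto simp: order_def)
  moreover have "carrier cyclic_complement \<noteq> {\<one>\<^bsub>cyclic_complement\<^esub>}"
    using order_cyclic_complement k_ge_2 by (auto simp: order_def)
  moreover have "i = \<one>\<^bsub>cyclic_complement\<^esub>"
    if "i \<in> carrier cyclic_complement" "x \<in> carrier K - {\<one>}" "complement_action i x = x" for i x
    using that funpow_fixed_point_free[of i x]
    by (cases "i = 0") (auto simp: cyclic_complement_def complement_action_def)
  ultimately show ?thesis
    using group_axioms group_cyclic_complement finite_carrier
    by (auto simp: frobenius_def) (auto simp: cyclic_complement_def)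
qed

lemma admits_affine_action:
  assumes "order K > 1"
  shows "admits (carrier K) blocks (semidirect K cyclic_complement complement_action) affine_action"
    (is "admits _ _ ?G _")
proof -
  have G: "group ?G"
    using frobenius_complement[OF assms] by (auto simp: frobenius_def intro: group_semidirect)
  have Bij: "affine_action g \<in> Bij (carrier K)" if g: "g \<in> carrier ?G" for g
  proof -
    obtain x i where xi: "g = (x, i)" "x \<in> carrier K" "i < k"
      using g by (auto simp: semidirect_def cyclic_complement_def)
    have "bij_betw (affine_action g) (carrier K) (carrier K)"
    proof (subst bij_betw_cong)
      show "bij_betw (\<lambda>z. x \<otimes> (\<omega> ^^ i) z) (carrier K) (carrier K)"
        using xi by (intro bij_affine)
    qed (simp add: affine_action_def xi)
    then show ?thesis
      by (simp add: Bij_def affine_action_def xi)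
  qed
  have "group_action ?G (carrier K) affine_action"
  proof (rule group_action.intro, rule group_hom.intro[OF G group_BijGroup], unfold_locales, rule homI)
    fix g h assume gh: "g \<in> carrier ?G" "h \<in> carrier ?G"
    obtain x i where xi: "g = (x, i)" "x \<in> carrier K" "i < k"
      using gh by (auto simp: semidirect_def cyclic_complement_def)
    obtain y j where yj: "h = (y, j)" "y \<in> carrier K" "j < k"
      using gh by (auto simp: semidirect_def cyclic_complement_def)
    show "affine_action (g \<otimes>\<^bsub>?G\<^esub> h) =
        affine_action g \<otimes>\<^bsub>BijGroup (carrier K)\<^esub> affine_action h"
      using Bij[OF gh(1)] Bij[OF gh(2)] xi yj
      by (auto simp: BijGroup_def compose_def fun_eq_iff semidirect_def complement_action_def
          affine_action_def cyclic_complement_def funpow_mod funpow_mult funpow_funpow m_assoc)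
  qed (use Bij in \<open>auto simp: BijGroup_def\<close>)
  moreover have "(\<lambda>B. map (affine_action g) ` B) ` blocks = blocks" if g: "g \<in> carrier ?G" for g
  proof -
    obtain x i where xi: "g = (x, i)" "x \<in> carrier K" "i < k"
      using g by (auto simp: semidirect_def cyclic_complement_def)
    have im: "map (affine_action g) ` block a y = block (x \<otimes> (\<omega> ^^ i) a) ((\<omega> ^^ i) y)"
      if "a \<in> carrier K" "y \<in> carrier K" for a y
    proof -
      have "map (affine_action g) (base_list a y) = base_list (x \<otimes> (\<omega> ^^ i) a) ((\<omega> ^^ i) y)"
        using that xi
        by (auto simp: base_list_def affine_action_def funpow_mult m_assoc funpow_funpow add.commute)
      then show ?thesis
        by (simp add: block_def cyc_def image_Collect rotate_map[symmetric])
          (metis (no_types, lifting) rotate_map)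
    qed
    show ?thesis
    proof (intro equalityI subsetI)
      fix B assume "B \<in> (\<lambda>B. map (affine_action g) ` B) ` blocks"
      then obtain C where "C \<in> blocks" "B = map (affine_action g) ` C"
        by blast
      then show "B \<in> blocks"
        using xi(2) by (elim blocksE) (simp add: im funpow_eq_one_iff blocksI)
    next
      fix B assume "B \<in> blocks"
      then obtain b y where yb: "b \<in> carrier K" "y \<in> carrier K" "y \<noteq> \<one>" "B = block b y"
        by (rule blocksE)
      \<comment> \<open>The preimage of a block is the block of the preimages of \<open>b\<close> and \<open>y\<close>.\<close>
      obtain a where a: "a \<in> carrier K" "b = x \<otimes> (\<omega> ^^ i) a"
        using bij_affine[OF xi(2,3)] yb(1) by (auto simp: bij_betw_def)
      let ?C = "block a ((\<omega> ^^ (k - i)) y)"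
      have "B = map (affine_action g) ` ?C"
        unfolding im[OF a(1) funpow_closed[OF yb(2)]]
        using a yb xi funpow_inverse(1)[of y i] by simp
      moreover have "?C \<in> blocks"
        using a yb by (auto simp: funpow_eq_one_iff intro!: blocksI)
      ultimately show "B \<in> (\<lambda>B. map (affine_action g) ` B) ` blocks"
        by blast
    qed
  qed
  ultimately show ?thesis
    by (simp add: admits_def)
qed

end

theorem theorem3p8:
  fixes v k t :: nat and p e :: "nat \<Rightarrow> nat"
  assumes "v \<ge> 3"
    and "v = (\<Prod>i\<in>{1..t}. p i ^ e i)"
    and "\<And>i. i \<in> {1..t} \<Longrightarrow> prime (p i)"
    and "inj_on p {1..t}"
    and "\<And>i. i \<in> {1..t} \<Longrightarrow> e i \<ge> 1"
    and "prime k"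
    and "k dvd (GCD i\<in>{1..t}. p i ^ e i - 1)"
  shows "\<exists>(X :: nat set) \<B> (K :: nat monoid) (H :: nat monoid) \<theta> \<phi>.
           rpmd v k X \<B> \<and>
           frobenius K H \<theta> \<and> order K = v \<and> order H = k \<and>
           admits X \<B> (semidirect K H \<theta>) \<phi>"
proof -
  have "fpf_order k v"
    unfolding assms(2)
  proof (rule fpf_order_prod[OF assms(6)])
    fix i assume i: "i \<in> {1..t}"
    have "k dvd p i ^ e i - 1"
      using assms(7) i by (auto simp: dvd_Gcd_iff)
    then show "fpf_order k (p i ^ e i)"
      using assms(3)[OF i] assms(6) by (intro fpf_order_prime_power)
  qed
  then obtain K :: "nat monoid" and \<omega> where K: "fpf_automorphism K k \<omega>" "order K = v"
    by (auto simp: fpf_order_def)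
  interpret fpf_automorphism K k \<omega> by fact
  have "order K > 1"
    using assms(1) K(2) by simp
  then show ?thesis
    using design_rpmd frobenius_complement admits_affine_action order_cyclic_complement K(2)
    by blast
qed

end
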